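(* Let $F$ be a flat transversal of di-circuits of a strongly connected digraph $D$ and let $\mathcal O=(v_1,\dots,v_n)$ be a coherent cyclic order of the nodes of $D$ such that $F$ belongs to an opening of $\mathcal O$. Then a subset $S$ of nodes is $F$-stable if and only if $S$ is cyclic stable with respect to $\mathcal O$.
   Context: $D=(V,A)$ is a finite strongly connected loopless digraph on $n\ge 2$ nodes. A di-circuit is a directed circuit; $K$ also denotes its edge-set. Flat transversal: $F\subseteq A$ is a flat transversal of di-circuits if every di-circuit contains an element of $F$ and every edge lying on a di-circuit belongs to a di-circuit containing exactly one element of $F$. $F$-stability: a dicut of a digraph is the set of edges entering a subset $Z$ of nodes, provided no edge leaves $Z$. A sink set is a set of nodes none of which has a leaving edge. A set of nodes is sink-stable in a digraph if there are pairwise edge-disjoint dicuts of the digraph such that, after reversing all edges of these dicuts, the set becomes a sink set. A set of nodes is $F$-stable in $D$ if it is sink-stable in the digraph arising from $D$ by reversing the edges in $F$. Cyclic orders: a cyclic order $\mathcal O=(v_1,\dots,v_n)$ of $V$ is a placement of the nodes in this order at the vertices of a regular $n$-gon; the linear orders $[v_i,\dots,v_n,v_1,\dots,v_{i-1}]$ ($1\le i\le n$) all define the same cyclic order and are called the openings of $\mathcal O$. The edge-set belonging to an opening is the set of its backward edges, i.e. the edges of $D$ whose head precedes their tail in that linear order. Each edge $uv$ is represented by an arc going clockwise (in the direction of the order) from $u$ to $v$ outside the $n$-gon; the index $\mathrm{ind}(K)$ of a di-circuit $K$ is the number of times $K$ winds around the $n$-gon. Equivalently, $\mathrm{ind}(K)$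 is the number of edges of $K$ belonging to any given opening of $\mathcal O$. A cyclic order is coherent if each edge of $D$ belongs to a di-circuit of index $1$. Cyclic stability: the exchange of two consecutive elements $u,v$ in a cyclic order is elementary if there is no edge in either direction between $u$ and $v$. Two cyclic orders are equivalent if one can be obtained from the other by a sequence of elementary exchanges. An interval of a cyclic order is a set of consecutive elements. A stable set $S$ of nodes (no two nodes of $S$ are joined by an edge) is cyclic stable with respect to $\mathcal O$ if there is a cyclic order equivalent to $\mathcal O$ in which $S$ forms an interval. *)

theory Defs
  imports "Graph_Theory.Graph_Theory"
begin

text \<open>
  Digraphs are the multi-digraphs of \<open>Graph_Theory\<close>: parallel arcs are allowed and arcs have an
  identity of their own. Reversing arcs therefore keeps the arc set and only swaps tails and heads,
  even when this creates parallel arcs. A di-circuit is a \<open>cycle\<close> of \<open>Graph_Theory\<close> (an arc list),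
  and its edge-set is \<open>set p\<close>.
\<close>

definition flat_transversal :: "('a,'b) pre_digraph \<Rightarrow> 'b set \<Rightarrow> bool" where
  "flat_transversal D F \<longleftrightarrow>
     F \<subseteq> arcs D \<and>
     (\<forall>p. pre_digraph.cycle D p \<longrightarrow> set p \<inter> F \<noteq> {}) \<and>
     (\<forall>e\<in>arcs D. (\<exists>p. pre_digraph.cycle D p \<and> e \<in> set p) \<longrightarrow>
        (\<exists>p. pre_digraph.cycle D p \<and> e \<in> set p \<and> card (set p \<inter> F) = 1))"


section \<open>Sink-stable and F-stable sets\<close>

definition reverse_arcs :: "('a,'b) pre_digraph \<Rightarrow> 'b set \<Rightarrow> ('a,'b) pre_digraph" where
  "reverse_arcs D B =
     \<lparr> verts = verts D, arcs = arcs D,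
       tail = (\<lambda>e. if e \<in> B then head D e else tail D e),
       head = (\<lambda>e. if e \<in> B then tail D e else head D e) \<rparr>"

definition entering :: "('a,'b) pre_digraph \<Rightarrow> 'a set \<Rightarrow> 'b set" where
  "entering D Z = {e \<in> arcs D. tail D e \<notin> Z \<and> head D e \<in> Z}"

definition leaving :: "('a,'b) pre_digraph \<Rightarrow> 'a set \<Rightarrow> 'b set" where
  "leaving D Z = {e \<in> arcs D. tail D e \<in> Z \<and> head D e \<notin> Z}"

definition dicut :: "('a,'b) pre_digraph \<Rightarrow> 'b set \<Rightarrow> bool" where
  "dicut D C \<longleftrightarrow> (\<exists>Z. Z \<subseteq> verts D \<and> leaving D Z = {} \<and> C = entering D Z)"

definition sink_set :: "('a,'b) pre_digraph \<Rightarrow> 'a set \<Rightarrow> bool" where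
  "sink_set D S \<longleftrightarrow> S \<subseteq> verts D \<and> (\<forall>v\<in>S. out_arcs D v = {})"

definition sink_stable :: "('a,'b) pre_digraph \<Rightarrow> 'a set \<Rightarrow> bool" where
  "sink_stable D S \<longleftrightarrow>
     (\<exists>\<C>. (\<forall>C\<in>\<C>. dicut D C) \<and> pairwise disjnt \<C> \<and> sink_set (reverse_arcs D (\<Union>\<C>)) S)"

definition F_stable :: "('a,'b) pre_digraph \<Rightarrow> 'b set \<Rightarrow> 'a set \<Rightarrow> bool" where
  "F_stable D F S \<longleftrightarrow> sink_stable (reverse_arcs D F) S"


section \<open>Cyclic orders\<close>

text \<open>A cyclic order is represented by the set of its openings, i.e. by a rotation class of lists.\<close>

definition cyclic_order_of :: "'a list \<Rightarrow> 'a list set" where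
  "cyclic_order_of xs = {rotate k xs | k. True}"

definition cyclic_order :: "'a set \<Rightarrow> 'a list set \<Rightarrow> bool" where
  "cyclic_order V \<O> \<longleftrightarrow> (\<exists>xs. distinct xs \<and> set xs = V \<and> \<O> = cyclic_order_of xs)"

definition precedes :: "'a list \<Rightarrow> 'a \<Rightarrow> 'a \<Rightarrow> bool" where
  "precedes xs u v \<longleftrightarrow> (\<exists>i j. i < j \<and> j < length xs \<and> xs ! i = u \<and> xs ! j = v)"

definition backward_arcs :: "('a,'b) pre_digraph \<Rightarrow> 'a list \<Rightarrow> 'b set" where
  "backward_arcs D xs = {e \<in> arcs D. precedes xs (head D e) (tail D e)}"

text \<open>
  The number of steps of the regular polygon that a clockwise arc from \<open>u\<close> to \<open>v\<close> covers,
  read off as the position of \<open>v\<close> in the opening that starts at \<open>u\<close>.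
\<close>

definition clockwise_dist :: "'a list set \<Rightarrow> 'a \<Rightarrow> 'a \<Rightarrow> nat" where
  "clockwise_dist \<O> u v = (THE k. \<exists>xs\<in>\<O>. k < length xs \<and> xs ! 0 = u \<and> xs ! k = v)"

text \<open>
  The winding number of a di-circuit: its total clockwise length, one turn being \<open>card (verts D)\<close>
  steps. The division is exact on di-circuits; the lemma \<open>index_eq_card_backward_arcs\<close> below gives
  the description by backward arcs of an arbitrary opening.
\<close>

definition index :: "('a,'b) pre_digraph \<Rightarrow> 'a list set \<Rightarrow> 'b list \<Rightarrow> nat" where
  "index D \<O> p =
     (\<Sum>e\<in>set p. clockwise_dist \<O> (tail D e) (head D e)) div card (verts D)"

definition coherent :: "('a,'b) pre_digraph \<Rightarrow> 'a list set \<Rightarrow> bool" where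
  "coherent D \<O> \<longleftrightarrow> (\<forall>e\<in>arcs D. \<exists>p. pre_digraph.cycle D p \<and> e \<in> set p \<and> index D \<O> p = 1)"


section \<open>Cyclic stable sets\<close>

definition joined :: "('a,'b) pre_digraph \<Rightarrow> 'a \<Rightarrow> 'a \<Rightarrow> bool" where
  "joined D u v \<longleftrightarrow> (u, v) \<in> arcs_ends D \<or> (v, u) \<in> arcs_ends D"

text \<open>Any two consecutive elements of a cyclic order are the first two of one of its openings.\<close>

definition elementary_exchange ::
  "('a,'b) pre_digraph \<Rightarrow> 'a list set \<Rightarrow> 'a list set \<Rightarrow> bool" where
  "elementary_exchange D \<O> \<O>' \<longleftrightarrow>
     (\<exists>u v ws. \<O> = cyclic_order_of (u # v # ws) \<and> \<O>' = cyclic_order_of (v # u # ws) \<and>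
        \<not> joined D u v)"

definition equivalent_orders ::
  "('a,'b) pre_digraph \<Rightarrow> 'a list set \<Rightarrow> 'a list set \<Rightarrow> bool" where
  "equivalent_orders D = (elementary_exchange D)\<^sup>*\<^sup>*"

text \<open>The empty set counts as an interval.\<close>

definition interval :: "'a list set \<Rightarrow> 'a set \<Rightarrow> bool" where
  "interval \<O> I \<longleftrightarrow> (\<exists>xs\<in>\<O>. \<exists>k. I = set (take k xs))"

definition stable_set :: "('a,'b) pre_digraph \<Rightarrow> 'a set \<Rightarrow> bool" where
  "stable_set D S \<longleftrightarrow> S \<subseteq> verts D \<and> (\<forall>u\<in>S. \<forall>v\<in>S. \<not> joined D u v)"

definition cyclic_stable :: "('a,'b) pre_digraph \<Rightarrow> 'a list set \<Rightarrow> 'a set \<Rightarrow> bool" where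
  "cyclic_stable D \<O> S \<longleftrightarrow>
     stable_set D S \<and> (\<exists>\<O>'. equivalent_orders D \<O> \<O>' \<and> interval \<O>' S)"


section \<open>The index counts backward arcs\<close>

lemma cyclic_order_of_rotate:
  assumes "ys \<in> cyclic_order_of xs"
  shows "cyclic_order_of ys = cyclic_order_of xs"
proof -
  obtain k where k: "ys = rotate k xs" using assms by (auto simp: cyclic_order_of_def)
  have "\<exists>m. rotate j xs = rotate m ys" for j
  proof (cases "xs = []")
    case False
    then have k': "k mod length xs \<le> length xs" by (simp add: less_imp_le)
    have "rotate (j + (length xs - k mod length xs)) ys
        = rotate (j + (length xs - k mod length xs)) (rotate (k mod length xs) xs)"
      using k by (simp add: rotate_conv_mod[of k xs])
    also have "\<dots> = rotate (j + length xs) xs"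
      using k' by (simp add: rotate_rotate)
    also have "\<dots> = rotate j xs" 
      using rotate_conv_mod[of "j + length xs" xs] rotate_conv_mod[of j xs] by simp
    finally show ?thesis by metis
  qed (simp add: k)
  then show ?thesis using k by (auto simp: cyclic_order_of_def rotate_rotate)
qed

lemma clockwise_dist_nth:
  assumes "distinct xs" "i < length xs" "j < length xs"
  shows "clockwise_dist (cyclic_order_of xs) (xs ! i) (xs ! j)
       = (if i \<le> j then j - i else length xs + j - i)" (is "_ = ?d")
  unfolding clockwise_dist_def
proof (rule the_equality)
  let ?n = "length xs"
  have eq: "(i + ?d) mod ?n = j" "?d < ?n" using assms by auto
  have "rotate i xs ! 0 = xs ! i"
    using assms nth_rotate[of 0 xs i] by fastforce
  moreover have "rotate i xs ! ?d = xs ! j"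
    using eq assms nth_rotate[of ?d xs i] by simp
  moreover have "rotate i xs \<in> cyclic_order_of xs" by (auto simp: cyclic_order_of_def)
  ultimately show "\<exists>ys\<in>cyclic_order_of xs. ?d < length ys \<and> ys ! 0 = xs ! i \<and> ys ! ?d = xs ! j"
    using eq(2) by (metis length_rotate)
next
  fix k
  let ?n = "length xs"
  assume "\<exists>ys\<in>cyclic_order_of xs. k < length ys \<and> ys ! 0 = xs ! i \<and> ys ! k = xs ! j"
  then obtain m where m: "k < ?n" "rotate m xs ! 0 = xs ! i" "rotate m xs ! k = xs ! j"
    by (auto simp: cyclic_order_of_def)
  have pos: "0 < ?n" using assms(2) by linarith
  have "xs ! (m mod ?n) = xs ! i" using m(2) nth_rotate[of 0 xs m] pos by simp
  then have mi: "m mod ?n = i" using assms pos by (simp add: nth_eq_iff_index_eq)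
  have "xs ! ((m + k) mod ?n) = xs ! j" using m(1,3) nth_rotate[of k xs m] by simp
  then have "(m + k) mod ?n = j" using assms pos by (simp add: nth_eq_iff_index_eq)
  then have j: "(i + k) mod ?n = j" using mi by (metis mod_add_left_eq)
  show "k = ?d"
  proof (cases "i + k < ?n")
    case True then show ?thesis using j by auto
  next
    case False
    then have "(i + k) mod ?n = i + k - ?n"
      using m(1) assms(2) by (simp add: le_mod_geq)
    then show ?thesis using j False m(1) by auto
  qed
qed

lemma (in wf_digraph) cycle_clockwise_length:
  assumes "distinct xs" "set xs = verts G" "awalk u p v" "u = xs ! i" "v = xs ! j"
    "i < length xs" "j < length xs"
  shows "i + (\<Sum>e\<leftarrow>p. clockwise_dist (cyclic_order_of xs) (tail G e) (head G e))
       = j + length xs * length (filter (\<lambda>e. precedes xs (head G e) (tail G e)) p)"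
  using assms(3-)
proof (induction p arbitrary: u i)
  case Nil
  then show ?case using assms(1) by (auto simp: awalk_Nil_iff nth_eq_iff_index_eq)
next
  case (Cons e p)
  then have e: "e \<in> arcs G" "tail G e = u" and p: "awalk (head G e) p v"
    by (auto simp: awalk_Cons_iff)
  then have "head G e \<in> set xs" using assms(2) by simp
  then obtain k where k: "k < length xs" "head G e = xs ! k" by (metis in_set_conv_nth)
  have prec: "precedes xs (head G e) (tail G e) \<longleftrightarrow> k < i"
    using k e Cons.prems assms(1) by (auto simp: precedes_def nth_eq_iff_index_eq)
  have IH: "k + (\<Sum>e\<leftarrow>p. clockwise_dist (cyclic_order_of xs) (tail G e) (head G e))
       = j + length xs * length (filter (\<lambda>e. precedes xs (head G e) (tail G e)) p)"
    using Cons.IH[OF p k(2) Cons.prems(3) k(1) Cons.prems(5)] .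
  have d: "clockwise_dist (cyclic_order_of xs) (tail G e) (head G e)
        = (if i \<le> k then k - i else length xs + k - i)"
    using clockwise_dist_nth[OF assms(1) Cons.prems(4) k(1)] k e Cons.prems(2) by simp
  show ?case using IH d prec Cons.prems(4) by (auto simp: algebra_simps)
qed

lemma (in fin_digraph) index_eq_card_backward_arcs:
  assumes "cyclic_order (verts G) \<O>" "xs \<in> \<O>" "cycle p"
  shows "index G \<O> p = card (set p \<inter> backward_arcs G xs)"
proof -
  obtain ys where ys: "distinct ys" "set ys = verts G" "\<O> = cyclic_order_of ys"
    using assms(1) by (auto simp: cyclic_order_def)
  have \<O>: "\<O> = cyclic_order_of xs" using cyclic_order_of_rotate assms(2) ys(3) by blast
  obtain m where "xs = rotate m ys"
    using assms(2) unfolding ys(3) cyclic_order_of_def by blast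
  then have xs: "distinct xs" "set xs = verts G" using ys(1,2) by simp_all
  obtain u where u: "awalk u p u" "distinct (tl (awalk_verts u p))" "p \<noteq> []"
    using assms(3) by (auto simp: cycle_def)
  have "u \<in> set xs" using u(1) xs(2) by (auto simp: awalk_def)
  then obtain i where i: "i < length xs" "u = xs ! i" by (metis in_set_conv_nth)
  have dp: "distinct p" by (rule distinct_tl_verts_imp_distinct[OF u(1,2)])
  have pa: "set p \<subseteq> arcs G" using u(1) by (auto simp: awalk_def)
  have n: "card (verts G) = length xs" using xs by (metis distinct_card)
  have "(\<Sum>e\<in>set p. clockwise_dist \<O> (tail G e) (head G e))
      = length xs * length (filter (\<lambda>e. precedes xs (head G e) (tail G e)) p)"
    using cycle_clockwise_length[OF xs u(1) i(2) i(2) i(1) i(1)] dp \<O>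
    by (simp add: sum_list_distinct_conv_sum_set)
  moreover have "length (filter (\<lambda>e. precedes xs (head G e) (tail G e)) p)
      = card (set p \<inter> backward_arcs G xs)"
  proof -
    have "set (filter (\<lambda>e. precedes xs (head G e) (tail G e)) p) = set p \<inter> backward_arcs G xs"
      using pa by (auto simp: backward_arcs_def)
    then show ?thesis using dp by (metis distinct_card distinct_filter)
  qed
  ultimately show ?thesis using i(1) n by (auto simp: index_def)
qed

end

theory Submission
  imports Defs
begin

text \<open>
  Write \<open>D\<^sub>F\<close> for \<open>D\<close> with the arcs of \<open>F\<close> reversed. If \<open>F\<close> is the set of backward arcs of a linear
  order of the nodes, then this order is a topological order of \<open>D\<^sub>F\<close>.

  From dicuts to exchanges: let \<open>Z\<close> be a node set that no arc of \<open>D\<^sub>F\<close> leaves. A node of \<open>Z\<close> that comes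
  before a node outside \<open>Z\<close> is not joined to it, so the nodes of \<open>Z\<close> can be pushed to the end of
  the order by elementary exchanges. Rotating, one obtains the opening in which \<open>Z\<close> comes first,
  and it has as backward arcs exactly those arcs that are obtained from \<open>F\<close> by switching the arcs
  of the dicut entering \<open>Z\<close> (\<open>dicut_switch\<close>). A dicut disjoint from the one just reversed is still
  a dicut, so any disjoint family can be treated one by one (\<open>disjoint_dicuts_switch\<close>). Once \<open>S\<close> is
  a sink set, the same pushing argument with \<open>Z = S\<close> makes it an interval.

  From exchanges to dicuts: an elementary exchange does not affect the backward arcs of the
  opening in which it takes place, and passing to another opening of the same cyclic order changes
  the indicator function of the backward arcs by the coboundary of an integer potential. So the
  backward arcs of any opening of any equivalent order differ from \<open>F\<close> by a coboundary
  (\<open>equivalent_orders_shift\<close>). As both indicator functions take only the values 0 and 1, the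
  potential grows by 0 or 1 along each arc of \<open>D\<^sub>F\<close>, and its upper level sets define disjoint dicuts
  that account for the whole change (\<open>shift_by_disjoint_dicuts\<close>). If a stable set \<open>S\<close> is an interval,
  some opening ends with \<open>S\<close>, and then no forward arc of that opening starts in \<open>S\<close>.
\<close>

section \<open>Precedence in a list\<close>

lemma precedes_Nil [simp]: "\<not> precedes [] u v"
  by (simp add: precedes_def)

lemma precedes_Cons [simp]:
  "precedes (x # xs) u v \<longleftrightarrow> u = x \<and> v \<in> set xs \<or> precedes xs u v"
proof
  assume "precedes (x # xs) u v"
  then obtain i j where ij: "i < j" "j < Suc (length xs)" "(x # xs) ! i = u" "(x # xs) ! j = v"
    by (auto simp: precedes_def)
  then obtain j' where j': "j = Suc j'" by (cases j) auto
  show "u = x \<and> v \<in> set xs \<or> precedes xs u v"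
  proof (cases i)
    case 0
    then show ?thesis using ij j' by auto
  next
    case (Suc i')
    then have "precedes xs u v" using ij j' unfolding precedes_def by auto
    then show ?thesis ..
  qed
next
  assume "u = x \<and> v \<in> set xs \<or> precedes xs u v"
  then show "precedes (x # xs) u v"
  proof
    assume "u = x \<and> v \<in> set xs"
    then obtain j where "j < length xs" "xs ! j = v" "u = x" by (auto simp: in_set_conv_nth)
    then show ?thesis unfolding precedes_def by (intro exI[of _ 0] exI[of _ "Suc j"]) auto
  next
    assume "precedes xs u v"
    then obtain i j where "i < j" "j < length xs" "xs ! i = u" "xs ! j = v"
      by (auto simp: precedes_def)
    then show ?thesis unfolding precedes_def by (intro exI[of _ "Suc i"] exI[of _ "Suc j"]) auto
  qed
qed

lemma precedes_append [simp]:
  "precedes (xs @ ys) u v \<longleftrightarrow> precedes xs u v \<or> precedes ys u v \<or> u \<in> set xs \<and> v \<in> set ys"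
  by (induction xs) auto

lemma precedes_in_set: "precedes xs u v \<Longrightarrow> u \<in> set xs \<and> v \<in> set xs"
  by (induction xs) auto

lemma precedes_filter [simp]:
  "precedes (filter P xs) u v \<longleftrightarrow> precedes xs u v \<and> P u \<and> P v"
  by (induction xs) (auto dest: precedes_in_set)

lemma precedes_asym: "distinct xs \<Longrightarrow> precedes xs u v \<Longrightarrow> \<not> precedes xs v u"
  by (induction xs) (auto dest: precedes_in_set)


section \<open>Cyclic orders and exchanges\<close>

lemma cyclic_order_of_self: "xs \<in> cyclic_order_of xs"
  unfolding cyclic_order_of_def by (auto intro: exI[of _ 0])

lemma cyclic_order_of_append: "cyclic_order_of (xs @ ys) = cyclic_order_of (ys @ xs)"
proof (rule cyclic_order_of_rotate)
  show "xs @ ys \<in> cyclic_order_of (ys @ xs)"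
    unfolding cyclic_order_of_def using rotate_append[of ys xs] by (metis (mono_tags) mem_Collect_eq)
qed

lemma cyclic_order_of_cut:
  assumes "ys \<in> cyclic_order_of xs"
  obtains as bs where "xs = as @ bs" "ys = bs @ as"
proof -
  obtain k where "ys = rotate k xs" using assms by (auto simp: cyclic_order_of_def)
  then show thesis
    using that[of "take (k mod length xs) xs" "drop (k mod length xs) xs"]
    by (simp add: rotate_drop_take)
qed

lemma cyclic_order_opening:
  assumes "cyclic_order V \<O>" "xs \<in> \<O>"
  shows "distinct xs" "set xs = V" "\<O> = cyclic_order_of xs"
proof -
  obtain ys where ys: "distinct ys" "set ys = V" "\<O> = cyclic_order_of ys"
    using assms(1) by (auto simp: cyclic_order_def)
  then show "\<O> = cyclic_order_of xs" using assms(2) cyclic_order_of_rotate by metis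
  show "distinct xs" "set xs = V" using ys assms(2) by (auto simp: cyclic_order_of_def)
qed

lemma joined_iff:
  "joined D u v \<longleftrightarrow>
     (\<exists>e\<in>arcs D. tail D e = u \<and> head D e = v \<or> tail D e = v \<and> head D e = u)"
  by (auto simp: joined_def arcs_ends_def arc_to_ends_def)

lemma exchange_adjacent:
  assumes "\<not> joined D u v"
  shows "equivalent_orders D (cyclic_order_of (xs @ u # v # ys)) (cyclic_order_of (xs @ v # u # ys))"
proof -
  have "elementary_exchange D (cyclic_order_of (u # v # ys @ xs)) (cyclic_order_of (v # u # ys @ xs))"
    using assms unfolding elementary_exchange_def by blast
  then show ?thesis
    using cyclic_order_of_append[of xs "u # v # ys"] cyclic_order_of_append[of xs "v # u # ys"]
    by (simp add: equivalent_orders_def)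
qed

lemma equivalent_orders_trans [trans]:
  "equivalent_orders D \<O> \<O>' \<Longrightarrow> equivalent_orders D \<O>' \<O>'' \<Longrightarrow> equivalent_orders D \<O> \<O>''"
  unfolding equivalent_orders_def by (rule rtranclp_trans)

lemma exchange_past_list:
  assumes "\<forall>v\<in>set vs. \<not> joined D u v"
  shows "equivalent_orders D (cyclic_order_of (xs @ u # vs @ ys)) (cyclic_order_of (xs @ vs @ u # ys))"
  using assms
proof (induction vs arbitrary: xs)
  case Nil
  then show ?case by (simp add: equivalent_orders_def)
next
  case (Cons v vs)
  have "equivalent_orders D (cyclic_order_of (xs @ u # v # vs @ ys)) (cyclic_order_of (xs @ v # u # vs @ ys))"
    using Cons.prems by (intro exchange_adjacent) simp
  also have "equivalent_orders D \<dots> (cyclic_order_of (xs @ v # vs @ u # ys))"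
    using Cons.IH[of "xs @ [v]"] Cons.prems by simp
  finally show ?case by simp
qed

text \<open>Insertion sort with the key \<open>x \<in> Z\<close> only ever exchanges a node of \<open>Z\<close> with a later node
  outside \<open>Z\<close>. The prefix \<open>ws\<close> is there for the induction.\<close>

lemma push_to_end:
  assumes "\<And>u v. precedes xs u v \<Longrightarrow> u \<in> Z \<Longrightarrow> v \<notin> Z \<Longrightarrow> \<not> joined D u v"
  shows "equivalent_orders D (cyclic_order_of (ws @ xs))
           (cyclic_order_of (ws @ filter (\<lambda>x. x \<notin> Z) xs @ filter (\<lambda>x. x \<in> Z) xs))"
  using assms
proof (induction xs arbitrary: ws)
  case Nil
  then show ?case by (simp add: equivalent_orders_def)
next
  case (Cons x xs)
  let ?out = "filter (\<lambda>x. x \<notin> Z) xs" and ?in = "filter (\<lambda>x. x \<in> Z) xs"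
  have IH: "equivalent_orders D (cyclic_order_of (ws @ x # xs))
              (cyclic_order_of (ws @ x # ?out @ ?in))"
    using Cons.IH[of "ws @ [x]"] Cons.prems by simp
  show ?case
  proof (cases "x \<in> Z")
    case True
    note IH
    also have "equivalent_orders D (cyclic_order_of (ws @ x # ?out @ ?in))
                 (cyclic_order_of (ws @ ?out @ x # ?in))"
      using Cons.prems True by (intro exchange_past_list) simp
    finally show ?thesis using True by simp
  next
    case False
    then show ?thesis using IH by simp
  qed
qed


section \<open>From disjoint dicuts to exchanges\<close>

lemma reverse_arcs_simps [simp]:
  "verts (reverse_arcs D B) = verts D"
  "arcs (reverse_arcs D B) = arcs D"
  "tail (reverse_arcs D B) e = (if e \<in> B then head D e else tail D e)"
  "head (reverse_arcs D B) e = (if e \<in> B then tail D e else head D e)"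
  by (simp_all add: reverse_arcs_def)

lemma reverse_arcs_twice:
  "reverse_arcs (reverse_arcs D F) C = reverse_arcs D ((F - C) \<union> (C - F))"
  by (auto simp: reverse_arcs_def)

text \<open>Since \<open>xs\<close> is a topological order of the reversed digraph, an arc joining a node \<open>u\<close> to a later
  node \<open>v\<close> would be directed from \<open>u\<close> to \<open>v\<close> there, and would leave \<open>Z\<close>.\<close>

lemma not_joined_later_outside:
  assumes "distinct xs" "leaving (reverse_arcs D (backward_arcs D xs)) Z = {}"
    and uv: "precedes xs u v" "u \<in> Z" "v \<notin> Z"
  shows "\<not> joined D u v"
proof
  assume "joined D u v"
  then obtain e where e: "e \<in> arcs D"
      "tail D e = u \<and> head D e = v \<or> tail D e = v \<and> head D e = u"
    by (auto simp: joined_iff)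
  have "\<not> precedes xs v u" using precedes_asym assms(1) uv(1) by metis
  then have "e \<in> leaving (reverse_arcs D (backward_arcs D xs)) Z"
    using e uv by (auto simp: leaving_def backward_arcs_def)
  then show False using assms(2) by simp
qed

text \<open>Pushing the shore \<open>Z\<close> of the dicut to the end leaves the backward arcs as they are; it is the
  rotation bringing \<open>Z\<close> to the front that reverses the dicut.\<close>

lemma dicut_switch:
  fixes D :: "('a,'b) pre_digraph"
  assumes "wf_digraph D" "distinct xs" "set xs = verts D"
    and "dicut (reverse_arcs D (backward_arcs D xs)) C"
  obtains ys where "distinct ys" "set ys = verts D"
    "equivalent_orders D (cyclic_order_of xs) (cyclic_order_of ys)"
    "backward_arcs D ys = (backward_arcs D xs - C) \<union> (C - backward_arcs D xs)"
proof -
  let ?F = "backward_arcs D xs"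
  obtain Z where Z: "leaving (reverse_arcs D ?F) Z = {}" and C: "C = entering (reverse_arcs D ?F) Z"
    using assms(4) by (auto simp: dicut_def)
  let ?out = "filter (\<lambda>x. x \<notin> Z) xs" and ?in = "filter (\<lambda>x. x \<in> Z) xs"
  have "equivalent_orders D (cyclic_order_of xs) (cyclic_order_of (?out @ ?in))"
    using push_to_end[of xs Z D "[]", OF not_joined_later_outside[OF assms(2) Z]] by simp
  then have eq: "equivalent_orders D (cyclic_order_of xs) (cyclic_order_of (?in @ ?out))"
    by (simp add: cyclic_order_of_append[of ?in ?out])
  have arcs_D: "e \<in> arcs D" if "e \<in> backward_arcs D zs \<or> e \<in> C" for e zs
    using that by (auto simp: C backward_arcs_def entering_def)
  have "e \<in> backward_arcs D (?in @ ?out) \<longleftrightarrow> e \<in> (?F - C) \<union> (C - ?F)" if e: "e \<in> arcs D" for e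
  proof -
    have "tail D e \<in> set xs" "head D e \<in> set xs" using e assms(1,3) by (auto simp: wf_digraph_def)
    moreover have "e \<notin> leaving (reverse_arcs D ?F) Z" using Z by simp
    ultimately show ?thesis
      using e unfolding C leaving_def entering_def backward_arcs_def
      by (auto dest: precedes_in_set split: if_splits)
  qed
  then have "backward_arcs D (?in @ ?out) = (?F - C) \<union> (C - ?F)"
    using arcs_D by blast
  then show thesis using eq assms(2,3) by (intro that[of "?in @ ?out"]) auto
qed

text \<open>The only way to create an arc leaving the shore \<open>Z\<close> is to reverse an arc entering \<open>Z\<close>, that is,
  an arc of \<open>C\<close> itself.\<close>

lemma dicut_after_reversal:
  assumes "dicut D C" "C \<inter> B = {}"
  shows "dicut (reverse_arcs D B) C"
proof -
  obtain Z where Z: "Z \<subseteq> verts D" "leaving D Z = {}" "C = entering D Z"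
    using assms(1) by (auto simp: dicut_def)
  have "leaving (reverse_arcs D B) Z = {}" "entering (reverse_arcs D B) Z = C"
    using Z(2,3) assms(2) by (auto simp: leaving_def entering_def split: if_splits)
  then show ?thesis using Z(1) unfolding dicut_def by auto
qed

lemma disjoint_dicuts_switch:
  fixes D :: "('a,'b) pre_digraph"
  assumes "finite \<C>" "wf_digraph D" "distinct xs" "set xs = verts D"
    and "\<forall>C\<in>\<C>. dicut (reverse_arcs D (backward_arcs D xs)) C" "pairwise disjnt \<C>"
  shows "\<exists>ys. distinct ys \<and> set ys = verts D \<and>
    equivalent_orders D (cyclic_order_of xs) (cyclic_order_of ys) \<and>
    reverse_arcs D (backward_arcs D ys) = reverse_arcs (reverse_arcs D (backward_arcs D xs)) (\<Union>\<C>)"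
  using assms
proof (induction \<C> arbitrary: xs rule: finite_induct)
  case empty
  then show ?case
    by (intro exI[of _ xs]) (simp add: equivalent_orders_def reverse_arcs_twice)
next
  case (insert C \<C>)
  let ?F = "backward_arcs D xs"
  obtain ys where ys: "distinct ys" "set ys = verts D"
      "equivalent_orders D (cyclic_order_of xs) (cyclic_order_of ys)"
      "backward_arcs D ys = (?F - C) \<union> (C - ?F)"
    using dicut_switch[OF insert.prems(1-3)] insert.prems(4) by blast
  have rev: "reverse_arcs D (backward_arcs D ys) = reverse_arcs (reverse_arcs D ?F) C"
    by (simp add: ys(4) reverse_arcs_twice)
  have disj: "C \<inter> C' = {}" if "C' \<in> \<C>" for C'
    using insert.prems(5) insert.hyps(2) that
    by (auto simp: pairwise_insert disjnt_def)
  have "\<forall>C'\<in>\<C>. dicut (reverse_arcs D (backward_arcs D ys)) C'"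
  proof
    fix C' assume "C' \<in> \<C>"
    then have "dicut (reverse_arcs D ?F) C'" "C' \<inter> C = {}"
      using insert.prems(4) disj by blast+
    then show "dicut (reverse_arcs D (backward_arcs D ys)) C'"
      unfolding rev by (rule dicut_after_reversal)
  qed
  moreover have "pairwise disjnt \<C>" using insert.prems(5) by (simp add: pairwise_insert)
  ultimately obtain zs where zs: "distinct zs" "set zs = verts D"
      "equivalent_orders D (cyclic_order_of ys) (cyclic_order_of zs)"
      "reverse_arcs D (backward_arcs D zs) = reverse_arcs (reverse_arcs D (backward_arcs D ys)) (\<Union>\<C>)"
    using insert.IH[OF insert.prems(1) ys(1,2)] by blast
  have "((?F - C) \<union> (C - ?F) - \<Union>\<C>) \<union> (\<Union>\<C> - ((?F - C) \<union> (C - ?F)))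
      = (?F - \<Union>(insert C \<C>)) \<union> (\<Union>(insert C \<C>) - ?F)"
    using disj by auto
  then have "reverse_arcs D (backward_arcs D zs) = reverse_arcs (reverse_arcs D ?F) (\<Union>(insert C \<C>))"
    using zs(4) by (simp add: ys(4) reverse_arcs_twice)
  then show ?case using zs(1-2) equivalent_orders_trans[OF ys(3) zs(3)] by blast
qed

lemma stable_if_sink_set:
  assumes "sink_set (reverse_arcs D B) S"
  shows "stable_set D S"
proof -
  have "\<not> (tail D e \<in> S \<and> head D e \<in> S)" if "e \<in> arcs D" for e
  proof
    assume "tail D e \<in> S \<and> head D e \<in> S"
    then have "tail (reverse_arcs D B) e \<in> S" by simp
    then have "out_arcs (reverse_arcs D B) (tail (reverse_arcs D B) e) = {}"
      using assms by (simp only: sink_set_def)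
    moreover have "e \<in> out_arcs (reverse_arcs D B) (tail (reverse_arcs D B) e)"
      using that by (simp add: out_arcs_def)
    ultimately show False by simp
  qed
  then show ?thesis using assms by (auto simp: sink_set_def stable_set_def joined_iff)
qed

lemma cyclic_stable_if_F_stable:
  fixes D :: "('a,'b) pre_digraph"
  assumes "fin_digraph D" "distinct xs" "set xs = verts D"
    and "F_stable D (backward_arcs D xs) S"
  shows "cyclic_stable D (cyclic_order_of xs) S"
proof -
  interpret fin_digraph D by fact
  obtain \<C> where \<C>: "\<forall>C\<in>\<C>. dicut (reverse_arcs D (backward_arcs D xs)) C" "pairwise disjnt \<C>"
      and sink: "sink_set (reverse_arcs (reverse_arcs D (backward_arcs D xs)) (\<Union>\<C>)) S"
    using assms(4) by (auto simp: F_stable_def sink_stable_def)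
  have "\<C> \<subseteq> Pow (arcs D)" using \<C>(1) by (auto simp: dicut_def entering_def)
  then have "finite \<C>" by (rule finite_subset) simp
  then obtain ys where ys: "distinct ys" "set ys = verts D"
      "equivalent_orders D (cyclic_order_of xs) (cyclic_order_of ys)"
      "sink_set (reverse_arcs D (backward_arcs D ys)) S"
    using disjoint_dicuts_switch[OF _ wf_digraph_axioms assms(2,3) \<C>] sink by metis
  let ?out = "filter (\<lambda>x. x \<notin> S) ys" and ?in = "filter (\<lambda>x. x \<in> S) ys"
  have "leaving (reverse_arcs D (backward_arcs D ys)) S = {}"
    using ys(4) by (auto simp: leaving_def sink_set_def out_arcs_def)
  note apart = not_joined_later_outside[OF ys(1) this]
  have "equivalent_orders D (cyclic_order_of ys) (cyclic_order_of (?out @ ?in))"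
    using push_to_end[of ys S D "[]", OF apart] by simp
  then have "equivalent_orders D (cyclic_order_of xs) (cyclic_order_of (?in @ ?out))"
    using equivalent_orders_trans[OF ys(3)] by (simp add: cyclic_order_of_append[of ?in ?out])
  moreover have "interval (cyclic_order_of (?in @ ?out)) S"
    unfolding interval_def
  proof (intro bexI exI)
    have "S \<subseteq> set ys" using ys(2,4) by (simp add: sink_set_def)
    then show "S = set (take (length ?in) (?in @ ?out))" by auto
  qed (rule cyclic_order_of_self)
  ultimately show ?thesis
    using stable_if_sink_set[OF ys(4)] by (auto simp: cyclic_stable_def)
qed


section \<open>From exchanges to disjoint dicuts\<close>

definition potential_shift ::
  "('a,'b) pre_digraph \<Rightarrow> ('a \<Rightarrow> int) \<Rightarrow> 'b set \<Rightarrow> 'b set \<Rightarrow> bool" where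
  "potential_shift D \<pi> F F' \<longleftrightarrow>
     (\<forall>e\<in>arcs D. of_bool (e \<in> F') = of_bool (e \<in> F) + \<pi> (head D e) - \<pi> (tail D e))"

lemma potential_shift_trans:
  assumes "potential_shift D \<pi> F F'" "potential_shift D \<rho> F' F''"
  shows "potential_shift D (\<lambda>v. \<pi> v + \<rho> v) F F''"
  using assms by (auto simp: potential_shift_def)

text \<open>Cutting \<open>as @ bs\<close> after \<open>as\<close> makes exactly the arcs from \<open>as\<close> to \<open>bs\<close> backward and the arcs from
  \<open>bs\<close> to \<open>as\<close> forward, which is the coboundary of minus the indicator function of \<open>as\<close>.\<close>

lemma other_opening_shift:
  assumes "wf_digraph D" "distinct xs" "set xs = verts D" "ys \<in> cyclic_order_of xs"
  shows "\<exists>\<pi>. potential_shift D \<pi> (backward_arcs D xs) (backward_arcs D ys)"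
proof -
  obtain as bs where ab: "xs = as @ bs" "ys = bs @ as"
    using assms(4) by (rule cyclic_order_of_cut)
  let ?\<pi> = "\<lambda>v. - of_bool (v \<in> set as) :: int"
  have "of_bool (e \<in> backward_arcs D ys) =
      of_bool (e \<in> backward_arcs D xs) + ?\<pi> (head D e) - ?\<pi> (tail D e)" if e: "e \<in> arcs D" for e
  proof -
    have "tail D e \<in> set as \<union> set bs" "head D e \<in> set as \<union> set bs"
      using e assms(1,3) ab(1) by (auto simp: wf_digraph_def)
    then show ?thesis
      using e assms(2) unfolding ab backward_arcs_def by (auto dest: precedes_in_set)
  qed
  then have "potential_shift D ?\<pi> (backward_arcs D xs) (backward_arcs D ys)"
    by (simp add: potential_shift_def)
  then show ?thesis by (rule exI[of _ ?\<pi>])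
qed

lemma exchange_backward_arcs:
  assumes "\<not> joined D u v"
  shows "backward_arcs D (v # u # ws) = backward_arcs D (u # v # ws)"
  using assms by (auto simp: backward_arcs_def joined_iff)

lemma equivalent_orders_shift:
  assumes "wf_digraph D" "distinct xs" "set xs = verts D"
    and "equivalent_orders D (cyclic_order_of xs) \<O>"
  shows "cyclic_order (verts D) \<O> \<and>
    (\<forall>ys\<in>\<O>. \<exists>\<pi>. potential_shift D \<pi> (backward_arcs D xs) (backward_arcs D ys))"
  using assms(4) unfolding equivalent_orders_def
proof (induction rule: rtranclp_induct)
  case base
  then show ?case
    using other_opening_shift[OF assms(1-3)] assms(2,3) by (auto simp: cyclic_order_def)
next
  case (step \<O> \<O>')
  obtain u v ws where uv: "\<O> = cyclic_order_of (u # v # ws)" "\<O>' = cyclic_order_of (v # u # ws)"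
      "\<not> joined D u v"
    using step.hyps(2) by (auto simp: elementary_exchange_def)
  have uvws: "u # v # ws \<in> \<O>" by (simp add: uv(1) cyclic_order_of_self)
  then have "distinct (u # v # ws)" "set (u # v # ws) = verts D"
    using cyclic_order_opening step.IH by blast+
  then have vuws: "distinct (v # u # ws)" "set (v # u # ws) = verts D" by auto
  obtain \<pi> where "potential_shift D \<pi> (backward_arcs D xs) (backward_arcs D (u # v # ws))"
    using step.IH uvws by blast
  then have \<pi>: "potential_shift D \<pi> (backward_arcs D xs) (backward_arcs D (v # u # ws))"
    by (simp only: exchange_backward_arcs[OF uv(3)])
  have "\<exists>\<pi>. potential_shift D \<pi> (backward_arcs D xs) (backward_arcs D ys)" if "ys \<in> \<O>'" for ys
    using other_opening_shift[OF assms(1) vuws] that uv(2) potential_shift_trans[OF \<pi>] by blast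
  then show ?case using vuws uv(2) unfolding cyclic_order_def by blast
qed

text \<open>Along each arc of \<open>D\<close> with \<open>F\<close> reversed the potential grows by 0 or 1, and by 1 exactly on the
  arcs where \<open>F\<close> and \<open>F'\<close> differ. Such an arc enters precisely one of the upper level sets.\<close>

lemma shift_by_disjoint_dicuts:
  assumes "wf_digraph D" "potential_shift D \<pi> F F'"
  obtains \<C> where "\<forall>C\<in>\<C>. dicut (reverse_arcs D F) C" "pairwise disjnt \<C>"
    "\<forall>e\<in>arcs D. e \<in> F' \<longleftrightarrow> e \<in> (F - \<Union>\<C>) \<union> (\<Union>\<C> - F)"
proof -
  let ?G = "reverse_arcs D F"
  define Z where "Z k = {v \<in> verts D. k \<le> \<pi> v}" for k
  have step: "\<pi> (head ?G e) = \<pi> (tail ?G e) + of_bool ((e \<in> F) \<noteq> (e \<in> F'))" if "e \<in> arcs D" for e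
    using assms(2) that by (auto simp: potential_shift_def of_bool_def split: if_splits)
  have ends: "tail ?G e \<in> verts D" "head ?G e \<in> verts D" if "e \<in> arcs D" for e
    using assms(1) that by (auto simp: wf_digraph_def)
  have enters: "e \<in> entering ?G (Z k) \<longleftrightarrow>
      e \<in> arcs D \<and> (e \<in> F) \<noteq> (e \<in> F') \<and> k = \<pi> (head ?G e)" for e k
  proof (cases "e \<in> arcs D")
    case True
    then show ?thesis
      using step[OF True] ends[OF True]
      unfolding entering_def Z_def by (auto simp del: reverse_arcs_simps(3,4) simp: of_bool_def)
  qed (simp add: entering_def)
  define \<C> where "\<C> = range (\<lambda>k. entering ?G (Z k))"
  have "dicut ?G (entering ?G (Z k))" for k
  proof -
    have "e \<notin> leaving ?G (Z k)" for e
    proof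
      assume "e \<in> leaving ?G (Z k)"
      then have e: "e \<in> arcs D" "tail ?G e \<in> Z k" "head ?G e \<notin> Z k" by (simp_all add: leaving_def)
      have "\<pi> (tail ?G e) \<le> \<pi> (head ?G e)" unfolding step[OF e(1)] by simp
      then show False using e ends[OF e(1)] unfolding Z_def by (simp del: reverse_arcs_simps(3,4))
    qed
    then have "leaving ?G (Z k) = {}" by blast
    moreover have "Z k \<subseteq> verts ?G" by (auto simp: Z_def)
    ultimately show ?thesis unfolding dicut_def by blast
  qed
  then have dicuts: "\<forall>C\<in>\<C>. dicut ?G C" by (simp add: \<C>_def)
  have disj: "pairwise disjnt \<C>"
  proof (rule pairwiseI)
    fix C C' assume "C \<in> \<C>" "C' \<in> \<C>" "C \<noteq> C'"
    then obtain k k' where "C = entering ?G (Z k)" "C' = entering ?G (Z k')" "k \<noteq> k'"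
      by (auto simp: \<C>_def)
    then show "disjnt C C'" by (auto simp: disjnt_iff enters)
  qed
  have Union: "e \<in> \<Union>\<C> \<longleftrightarrow> (e \<in> F) \<noteq> (e \<in> F')" if "e \<in> arcs D" for e
    using that unfolding \<C>_def by (simp add: enters)
  have "\<forall>e\<in>arcs D. e \<in> F' \<longleftrightarrow> e \<in> (F - \<Union>\<C>) \<union> (\<Union>\<C> - F)"
  proof
    fix e assume "e \<in> arcs D"
    then show "e \<in> F' \<longleftrightarrow> e \<in> (F - \<Union>\<C>) \<union> (\<Union>\<C> - F)"
      unfolding Un_iff Diff_iff by (simp only: Union) (cases "e \<in> F"; simp)
  qed
  with dicuts disj show thesis by (rule that)
qed

lemma F_stable_if_cyclic_stable:
  fixes D :: "('a,'b) pre_digraph"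
  assumes "wf_digraph D" "distinct xs" "set xs = verts D"
    and "cyclic_stable D (cyclic_order_of xs) S"
  shows "F_stable D (backward_arcs D xs) S"
proof -
  let ?F = "backward_arcs D xs"
  obtain \<O> ys k where S: "stable_set D S" "S = set (take k ys)"
      and \<O>: "equivalent_orders D (cyclic_order_of xs) \<O>" "ys \<in> \<O>"
    using assms(4) by (auto simp: cyclic_stable_def interval_def)
  note shift = equivalent_orders_shift[OF assms(1-3) \<O>(1)]
  note ys = cyclic_order_opening[OF conjunct1[OF shift] \<O>(2)]
  \<comment> \<open>With the interval \<open>S\<close> moved to the end, a forward arc starting in \<open>S\<close> would also end in \<open>S\<close>.\<close>
  let ?zs = "drop k ys @ take k ys"
  have "?zs \<in> \<O>"
    using cyclic_order_of_self[of ?zs] cyclic_order_of_append[of "drop k ys" "take k ys"] ys(3) by simp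
  then obtain \<pi> where "potential_shift D \<pi> ?F (backward_arcs D ?zs)" using shift by blast
  then obtain \<C> where \<C>: "\<forall>C\<in>\<C>. dicut (reverse_arcs D ?F) C" "pairwise disjnt \<C>"
      and F': "\<forall>e\<in>arcs D. e \<in> backward_arcs D ?zs \<longleftrightarrow> e \<in> (?F - \<Union>\<C>) \<union> (\<Union>\<C> - ?F)"
    by (rule shift_by_disjoint_dicuts[OF assms(1)])
  let ?G = "reverse_arcs (reverse_arcs D ?F) (\<Union>\<C>)"
  have tail_G: "tail ?G e = (if e \<in> backward_arcs D ?zs then head D e else tail D e)"
    if "e \<in> arcs D" for e
    unfolding reverse_arcs_twice using F' that by (simp only: reverse_arcs_simps)
  have "sink_set ?G S"
    unfolding sink_set_def
  proof (intro conjI ballI)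
    show "S \<subseteq> verts ?G"
      using S(1) by (simp add: stable_set_def)
  next
    fix v assume v: "v \<in> S"
    have no_arc: False if e: "e \<in> arcs D" "(if e \<in> backward_arcs D ?zs then head D e else tail D e) = v" for e
    proof -
      have "tail D e \<in> set ys" "head D e \<in> set ys" using e(1) assms(1) ys(2) by (auto simp: wf_digraph_def)
      moreover have "set ys = set (drop k ys) \<union> S"
        unfolding S(2) by (metis append_take_drop_id set_append sup_commute)
      moreover have "set (drop k ys) \<inter> S = {}"
        unfolding S(2) using ys(1) by (metis append_take_drop_id distinct_append inf_commute)
      moreover have "\<not> (tail D e \<in> S \<and> head D e \<in> S)"
        using S(1) e(1) by (auto simp: stable_set_def joined_iff)
      ultimately have "e \<in> backward_arcs D ?zs \<longleftrightarrow> tail D e \<in> S"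
        using e v S(2) by (auto simp: backward_arcs_def split: if_splits dest: precedes_in_set)
      then show False using e v \<open>\<not> (tail D e \<in> S \<and> head D e \<in> S)\<close> by (auto split: if_splits)
    qed
    have "e \<notin> out_arcs ?G v" for e
    proof
      assume "e \<in> out_arcs ?G v"
      then have "e \<in> arcs D" "tail ?G e = v" by (simp_all add: out_arcs_def)
      then show False using no_arc[of e] tail_G[of e] by metis
    qed
    then show "out_arcs ?G v = {}" by blast
  qed
  then show ?thesis
    unfolding F_stable_def sink_stable_def using \<C> by (intro exI[of _ \<C>] conjI)
qed


section \<open>Equivalence of the two notions of stability\<close>

theorem lemma7p6:
  fixes D :: "('a,'b) pre_digraph"
    and F :: "'b set" and \<O> :: "'a list set" and S :: "'a set"
  assumes "fin_digraph D" and "loopfree_digraph D"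
    and "strongly_connected D"
    and "card (verts D) \<ge> 2"
    and "flat_transversal D F"
    and "cyclic_order (verts D) \<O>"
    and "coherent D \<O>"
    and "\<exists>xs\<in>\<O>. F = backward_arcs D xs"
    and "S \<subseteq> verts D"
  shows "F_stable D F S \<longleftrightarrow> cyclic_stable D \<O> S"
proof -
  interpret fin_digraph D by fact
  obtain xs where xs: "xs \<in> \<O>" "F = backward_arcs D xs" using assms(8) by blast
  note xs_opening = cyclic_order_opening[OF assms(6) xs(1)]
  show ?thesis
    unfolding xs(2) xs_opening(3)
    using cyclic_stable_if_F_stable[OF assms(1) xs_opening(1,2)]
      F_stable_if_cyclic_stable[OF wf_digraph_axioms xs_opening(1,2)] by blast
qed

end
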